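(* Let $X$ be a finite dimensional real normed space with dimension at least $2$ and let $G=(V,E)$ be a graph with a spanning forest $T$. Then there exists a framework $(G,p)$ in the cylindrical normed space $Z=X\oplus_\infty\mathbb{R}$ such that: (i) $p_v-p_w\in K^\circ$ for every edge $vw$ of $T$, and (ii) $p_v-p_w\in K^c$ for every edge $vw$ of $G$ which is not an edge of $T$.
   Context: All graphs are finite, simple and undirected. $Z=X\oplus_\infty\mathbb{R}$ is the direct sum with norm $\|(x,y)\|_Z=\max\{\|x\|_X,|y|\}$. $K=\{(x,y)\in Z:\|x\|_X\leq|y|\}$; $K^\circ$ and $K^c$ denote its interior and complement in $Z$. A framework $(G,p)$ in $Z$ consists of a graph $G=(V,E)$ and a vector $p=(p_v)_{v\in V}\in Z^V$ with $p_v\neq p_w$ for all $vw\in E$. A spanning forest of $G$ is a subgraph with vertex set $V$ containing no cycles. *)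

theory Defs
  imports "HOL-Analysis.Analysis"
begin

section \<open>Finite simple undirected graphs\<close>

text \<open>
  An edge \<open>vw\<close> is the two-element set \<open>{v, w}\<close>.  (In the symmetric digraphs of the entry
  Graph_Theory, the closed walk \<open>v, w, v\<close> counts as a cycle, so the notion of forest given there
  is not the one for undirected graphs.)
\<close>

record 'v ugraph =
  verts :: "'v set"
  edges :: "'v set set"

definition simple_graph :: "'v ugraph \<Rightarrow> bool" where
  "simple_graph G \<longleftrightarrow> finite (verts G) \<and>
     (\<forall>e \<in> edges G. \<exists>v \<in> verts G. \<exists>w \<in> verts G. v \<noteq> w \<and> e = {v, w})"

definition subgraph :: "'v ugraph \<Rightarrow> 'v ugraph \<Rightarrow> bool" where
  "subgraph H G \<longleftrightarrow> simple_graph H \<and> verts H \<subseteq> verts G \<and> edges H \<subseteq> edges G"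

text \<open>A cycle is given by the list of its distinct vertices in cyclic order.\<close>

definition is_cycle :: "'v ugraph \<Rightarrow> 'v list \<Rightarrow> bool" where
  "is_cycle G c \<longleftrightarrow> 3 \<le> length c \<and> distinct c \<and> set c \<subseteq> verts G \<and>
     (\<forall>i < length c. {c ! i, c ! (Suc i mod length c)} \<in> edges G)"

definition spanning_forest :: "'v ugraph \<Rightarrow> 'v ugraph \<Rightarrow> bool" where
  "spanning_forest T G \<longleftrightarrow> subgraph T G \<and> verts T = verts G \<and> \<not> (\<exists>c. is_cycle T c)"


section \<open>The direct sum of two normed spaces with the maximum norm\<close>

text \<open>A separate type is needed because the product type carries the Euclidean combination
  of the two norms.\<close>

datatype ('a, 'b) linf_sum = Linf (linf_fst: 'a) (linf_snd: 'b)

instantiation linf_sum :: (real_vector, real_vector) real_vector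
begin

definition "0 = Linf 0 0"
definition "x + y = Linf (linf_fst x + linf_fst y) (linf_snd x + linf_snd y)"
definition "x - y = Linf (linf_fst x - linf_fst y) (linf_snd x - linf_snd y)"
definition "- x = Linf (- linf_fst x) (- linf_snd x)"
definition "r *\<^sub>R x = Linf (r *\<^sub>R linf_fst x) (r *\<^sub>R linf_snd x)"

instance
  by standard
    (simp_all add: zero_linf_sum_def plus_linf_sum_def minus_linf_sum_def uminus_linf_sum_def
      scaleR_linf_sum_def algebra_simps)

end

instantiation linf_sum :: (real_normed_vector, real_normed_vector) real_normed_vector
begin

definition norm_linf_sum :: "('a, 'b) linf_sum \<Rightarrow> real" where
  "norm_linf_sum x = max (norm (linf_fst x)) (norm (linf_snd x))"

definition dist_linf_sum :: "('a, 'b) linf_sum \<Rightarrow> ('a, 'b) linf_sum \<Rightarrow> real" where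
  "dist_linf_sum x y = norm (x - y)"

definition sgn_linf_sum :: "('a, 'b) linf_sum \<Rightarrow> ('a, 'b) linf_sum" where
  "sgn_linf_sum x = inverse (norm x) *\<^sub>R x"

definition uniformity_linf_sum :: "(('a, 'b) linf_sum \<times> ('a, 'b) linf_sum) filter" where
  "uniformity_linf_sum = (INF e\<in>{0 <..}. principal {(x, y). dist x y < e})"

definition open_linf_sum :: "('a, 'b) linf_sum set \<Rightarrow> bool" where
  "open_linf_sum U \<longleftrightarrow> (\<forall>x\<in>U. \<forall>\<^sub>F (x', y) in uniformity. x' = x \<longrightarrow> y \<in> U)"

instance
proof
  fix x y :: "('a, 'b) linf_sum" and r :: real
  show "norm x = 0 \<longleftrightarrow> x = 0"
    by (cases x) (auto simp: norm_linf_sum_def zero_linf_sum_def max_def)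
  show "norm (x + y) \<le> norm x + norm y"
    using norm_triangle_ineq[of "linf_fst x" "linf_fst y"]
      norm_triangle_ineq[of "linf_snd x" "linf_snd y"]
    unfolding norm_linf_sum_def plus_linf_sum_def linf_sum.sel by linarith
  show "norm (r *\<^sub>R x) = \<bar>r\<bar> * norm x"
    by (simp add: norm_linf_sum_def scaleR_linf_sum_def max_mult_distrib_left)
qed (rule dist_linf_sum_def sgn_linf_sum_def uniformity_linf_sum_def open_linf_sum_def)+

end


section \<open>The cylindrical space, its cone, and frameworks\<close>

type_synonym 'a cyl = "('a, real) linf_sum"

definition cyl_cone :: "'a::real_normed_vector cyl set" where
  "cyl_cone = {z. norm (linf_fst z) \<le> \<bar>linf_snd z\<bar>}"

text \<open>A vector \<open>p \<in> Z\<^sup>V\<close> is a total function on the vertex type; its values outside of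
  the vertex set play no role.\<close>

definition framework :: "'v ugraph \<Rightarrow> ('v \<Rightarrow> 'z) \<Rightarrow> bool" where
  "framework G p \<longleftrightarrow> simple_graph G \<and> (\<forall>v w. {v, w} \<in> edges G \<longrightarrow> p v \<noteq> p w)"

end

theory Submission
  imports Defs
begin

text \<open>
  Root every tree of the forest and place the vertex \<open>v\<close> of depth \<open>d\<close> at
  \<open>(d e + t\<^sub>v a, (-1)\<^sup>d z\<^sub>d)\<close> with \<open>0 < z\<^sub>d < 1\<close>, where \<open>e\<close> is a unit vector and the line
  \<open>e + \<real> a\<close> meets the unit ball only in \<open>e\<close>. The second coordinates of two vertices differ by less
  than 2, while the first coordinates are at distance at least the difference of the depths, so
  only pairs of consecutive depths can be separated by a vector of the cone. For those,
  \<open>z\<^sub>d + z\<^bsub>d+1\<^esub>\<close> is slightly larger than 1. The values \<open>t\<^sub>v\<close> at depth \<open>d\<close>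
  are distinct, so the excess can be chosen such that a vertex of depth \<open>d + 1\<close> with the same \<open>t\<close> as
  its parent is separated by a vector of the cone from its parent only. This persists when the
  values at depth \<open>d + 1\<close> are perturbed slightly to become distinct.
\<close>

section \<open>Rooted forests\<close>

text \<open>Otherwise take a longest path. Its first vertex has a neighbour other than the second
  vertex; by maximality this neighbour lies on the path, and the initial segment up to it closes to
  a cycle.\<close>

lemma acyclic_degree_le_1:
  assumes simple: "simple_graph T" and acyclic: "\<nexists>c. is_cycle T c" and ne: "verts T \<noteq> {}"
  shows "\<exists>v \<in> verts T. \<forall>u w. {v, u} \<in> edges T \<longrightarrow> {v, w} \<in> edges T \<longrightarrow> u = w"
proof (rule ccontr)
  assume "\<not> ?thesis"
  then have deg: "\<exists>u w. {v, u} \<in> edges T \<and> {v, w} \<in> edges T \<and> u \<noteq> w" if "v \<in> verts T" for v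
    using that by blast
  have fin: "finite (verts T)"
    using simple by (simp add: simple_graph_def)
  have edgeD: "v \<noteq> w \<and> v \<in> verts T \<and> w \<in> verts T" if "{v, w} \<in> edges T" for v w
    using simple that unfolding simple_graph_def by (metis doubleton_eq_iff)
  define path where "path c \<longleftrightarrow> c \<noteq> [] \<and> distinct c \<and> set c \<subseteq> verts T \<and>
    (\<forall>i. Suc i < length c \<longrightarrow> {c ! i, c ! Suc i} \<in> edges T)" for c
  obtain v0 where "v0 \<in> verts T" using ne by blast
  then have "path [v0]" by (simp add: path_def)
  moreover have "length c \<le> card (verts T)" if "path c" for c
    using that fin by (metis card_mono distinct_card path_def)
  ultimately obtain c where c: "path c" and longest: "\<And>c'. path c' \<Longrightarrow> length c' \<le> length c"
    using ex_has_greatest_nat[of path "[v0]" length "Suc (card (verts T))"]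
    by (auto simp: less_Suc_eq_le)
  from c have c_ne: "c \<noteq> []" and dist: "distinct c" and sub: "set c \<subseteq> verts T"
    and consec: "\<And>i. Suc i < length c \<Longrightarrow> {c ! i, c ! Suc i} \<in> edges T"
    by (auto simp: path_def)
  have "c ! 0 \<in> verts T"
    using c_ne sub by auto
  \<comment> \<open>On a path with one vertex \<open>c ! 1\<close> is unspecified. This is harmless:
    \<open>i \<noteq> 0\<close> and \<open>i < length c\<close> then contradict each other.\<close>
  then obtain w where w: "{c ! 0, w} \<in> edges T" and w1: "w \<noteq> c ! 1"
    using deg by metis
  have "w \<in> set c"
  proof (rule ccontr)
    assume "w \<notin> set c"
    then have "path (w # c)"
      using c w edgeD[OF w] by (auto simp: path_def nth_Cons insert_commute split: nat.split)
    from longest[OF this] show False by simp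
  qed
  then obtain i where i: "i < length c" "c ! i = w"
    by (auto simp: in_set_conv_nth)
  have "i \<noteq> 0" "i \<noteq> 1"
    using i w1 edgeD[OF w] by metis+
  then have "2 \<le> i" by linarith
  have len: "length (take (Suc i) c) = Suc i" using i by simp
  have "is_cycle T (take (Suc i) c)"
    unfolding is_cycle_def
  proof (intro conjI allI impI)
    show "3 \<le> length (take (Suc i) c)" using \<open>2 \<le> i\<close> i by simp
    show "distinct (take (Suc i) c)" using dist by simp
    show "set (take (Suc i) c) \<subseteq> verts T" using sub set_take_subset by fastforce
    fix j assume "j < length (take (Suc i) c)"
    then have "j \<le> i" using len by simp
    then show "{take (Suc i) c ! j, take (Suc i) c ! (Suc j mod length (take (Suc i) c))} \<in> edges T"
      unfolding len using i w consec[of j] by (cases "j = i") (auto simp: insert_commute)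
  qed
  with acyclic show False by blast
qed

text \<open>Induction removing a vertex with at most one neighbour: it is put back as a child of its
  neighbour, or, if isolated, as a root. A root is its own parent, so \<open>par\<close> is total on
  the vertices; the condition on depths keeps this loop from counting as an edge.\<close>

lemma acyclic_parent_depth:
  fixes T :: "'v ugraph"
  assumes "simple_graph T" "\<nexists>c. is_cycle T c"
  shows "\<exists>(par :: 'v \<Rightarrow> 'v) (depth :: 'v \<Rightarrow> nat).
    (\<forall>v \<in> verts T. par v \<in> verts T) \<and>
    (\<forall>v \<in> verts T. \<forall>w \<in> verts T. {v, w} \<in> edges T \<longleftrightarrow>
      par w = v \<and> depth w = Suc (depth v) \<or> par v = w \<and> depth v = Suc (depth w))"
  using assms
proof (induction "card (verts T)" arbitrary: T)
  case 0
  then have "verts T = {}" by (simp add: simple_graph_def)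
  then show ?case by simp
next
  case (Suc n)
  have fin: "finite (verts T)"
    using Suc.prems by (simp add: simple_graph_def)
  have irrefl: "{w} \<notin> edges T" for w
    using Suc.prems(1) unfolding simple_graph_def by (metis doubleton_eq_iff insert_absorb2)
  obtain v where v: "v \<in> verts T"
    and leaf: "\<And>u w. {v, u} \<in> edges T \<Longrightarrow> {v, w} \<in> edges T \<Longrightarrow> u = w"
    using acyclic_degree_le_1[OF Suc.prems] Suc.hyps(2) by force
  define T' where "T' = \<lparr>verts = verts T - {v}, edges = {e \<in> edges T. v \<notin> e}\<rparr>"
  have "simple_graph T'"
    using Suc.prems(1) unfolding simple_graph_def T'_def by fastforce
  moreover have "\<nexists>c. is_cycle T' c"
    using Suc.prems(2) unfolding is_cycle_def T'_def by fastforce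
  moreover have "n = card (verts T')"
    using Suc.hyps(2) v fin by (simp add: T'_def)
  ultimately obtain par and depth :: "'v \<Rightarrow> nat" where
    par: "\<forall>x \<in> verts T'. par x \<in> verts T'" and
    edges: "\<forall>x \<in> verts T'. \<forall>w \<in> verts T'. {x, w} \<in> edges T' \<longleftrightarrow>
      par w = x \<and> depth w = Suc (depth x) \<or> par x = w \<and> depth x = Suc (depth w)"
    using Suc.hyps(1) by blast
  have verts: "verts T = insert v (verts T')" "v \<notin> verts T'"
    using v by (auto simp: T'_def)
  have edges': "{x, w} \<in> edges T \<longleftrightarrow> {x, w} \<in> edges T'" if "x \<noteq> v" "w \<noteq> v" for x w
    using that by (simp add: T'_def)
  show ?case
  proof (cases "\<exists>u. {v, u} \<in> edges T")
    case True
    then obtain u where u: "{v, u} \<in> edges T" by blast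
    have u': "u \<in> verts T'"
      using u Suc.prems(1) irrefl unfolding simple_graph_def T'_def
      by (auto simp: doubleton_eq_iff)
    have nb: "{v, w} \<in> edges T \<longleftrightarrow> w = u" "{w, v} \<in> edges T \<longleftrightarrow> w = u" for w
      using leaf u by (auto simp: insert_commute)
    have "(\<forall>x \<in> verts T. (par(v := u)) x \<in> verts T) \<and>
      (\<forall>x \<in> verts T. \<forall>w \<in> verts T. {x, w} \<in> edges T \<longleftrightarrow>
        (par(v := u)) w = x \<and> (depth(v := Suc (depth u))) w = Suc ((depth(v := Suc (depth u))) x) \<or>
        (par(v := u)) x = w \<and> (depth(v := Suc (depth u))) x = Suc ((depth(v := Suc (depth u))) w))"
      using u' par edges verts edges' irrefl by (auto simp: nb)
    then show ?thesis by blast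
  next
    case False
    then have nb: "{v, w} \<notin> edges T" "{w, v} \<notin> edges T" for w
      by (auto simp: insert_commute)
    have "(\<forall>x \<in> verts T. (par(v := v)) x \<in> verts T) \<and>
      (\<forall>x \<in> verts T. \<forall>w \<in> verts T. {x, w} \<in> edges T \<longleftrightarrow>
        (par(v := v)) w = x \<and> (depth(v := 0)) w = Suc ((depth(v := 0)) x) \<or>
        (par(v := v)) x = w \<and> (depth(v := 0)) x = Suc ((depth(v := 0)) w))"
      using par edges verts edges' irrefl by (auto simp: nb)
    then show ?thesis by blast
  qed
qed

section \<open>A line touching the unit ball in a single point\<close>

text \<open>\<open>e\<close> is a point of the unit sphere of a plane at maximal Euclidean distance from the origin, and
  \<open>a\<close> is orthogonal to it; the plane is parametrised by \<^typ>\<open>complex\<close>.\<close>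

lemma line_touching_unit_ball:
  assumes "dim (UNIV :: 'a::real_normed_vector set) \<ge> 2"
  obtains e a :: "'a::real_normed_vector"
  where "norm e = 1" "\<And>r. r \<noteq> 0 \<Longrightarrow> 1 < norm (e + r *\<^sub>R a)" "a \<noteq> 0"
proof -
  obtain B :: "'a set" where "independent B" "card B = dim (UNIV :: 'a set)"
    using basis_exists[of UNIV] by blast
  then obtain S where S: "S \<subseteq> B" "card S = 2"
    using assms by (metis obtain_subset_with_card_n)
  then obtain b c where bc: "S = {b, c}" and "b \<noteq> c"
    by (auto simp: card_2_iff)
  have ind: "independent {b, c}"
    using independent_mono[OF \<open>independent B\<close> S(1)] unfolding bc .
  define L where "L z = Re z *\<^sub>R b + Im z *\<^sub>R c" for z
  have lin: "L (z + w) = L z + L w" "L (r *\<^sub>R z) = r *\<^sub>R L z" for z w r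
    by (simp_all add: L_def algebra_simps)
  have L_0: "z = 0" if "L z = 0" for z
  proof -
    have "(\<Sum>x\<in>{b, c}. (if x = b then Re z else Im z) *\<^sub>R x) = 0"
      using that \<open>b \<noteq> c\<close> by (auto simp: L_def)
    from independentD[OF ind _ subset_refl this, of b] independentD[OF ind _ subset_refl this, of c]
    show ?thesis
      using \<open>b \<noteq> c\<close> by (simp add: complex_eq_iff)
  qed
  have "continuous_on (sphere 0 1) (\<lambda>z. norm (L z))"
    unfolding L_def by (intro continuous_intros)
  then obtain u where u: "norm u = 1" and min: "\<And>z. norm z = 1 \<Longrightarrow> norm (L u) \<le> norm (L z)"
    using continuous_attains_inf[of "sphere (0::complex) 1" "\<lambda>z. norm (L z)"] by auto
  define m where "m = norm (L u)"
  have "m > 0"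
    using u L_0[of u] by (auto simp: m_def)
  \<comment> \<open>By homogeneity, the unit ball pulled back by \<open>L\<close> lies in the
    Euclidean disc of radius \<open>1 / m\<close> and meets its boundary at \<open>u / m\<close>.
    The tangent to the disc there has direction \<open>\<i> * u\<close>; all its other points lie
    outside the disc.\<close>
  have low: "m * norm z \<le> norm (L z)" for z
  proof (cases "z = 0")
    case False
    then have "m \<le> norm (L (inverse (norm z) *\<^sub>R z))"
      unfolding m_def by (intro min) simp
    then show ?thesis
      using False by (simp add: lin field_simps)
  qed simp
  show thesis
  proof
    show "norm (inverse m *\<^sub>R L u) = 1"
      using \<open>m > 0\<close> by (simp add: m_def)
    show "inverse m *\<^sub>R L (\<i> * u) \<noteq> 0"
      using \<open>m > 0\<close> u L_0[of "\<i> * u"] by auto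
    fix r :: real
    assume "r \<noteq> 0"
    have "1 < norm (Complex 1 r)"
      using \<open>r \<noteq> 0\<close> by (simp add: complex_norm)
    also have "\<dots> = norm (u + r *\<^sub>R (\<i> * u))"
    proof -
      have "u + r *\<^sub>R (\<i> * u) = Complex 1 r * u"
        by (simp add: complex_eq_iff)
      then show ?thesis using u by (simp add: norm_mult)
    qed
    also have "\<dots> \<le> inverse m * norm (L (u + r *\<^sub>R (\<i> * u)))"
      using low[of "u + r *\<^sub>R (\<i> * u)"] \<open>m > 0\<close> by (simp add: field_simps)
    also have "\<dots> = norm (inverse m *\<^sub>R L u + r *\<^sub>R (inverse m *\<^sub>R L (\<i> * u)))"
    proof -
      have "inverse m *\<^sub>R L u + r *\<^sub>R (inverse m *\<^sub>R L (\<i> * u)) = inverse m *\<^sub>R L (u + r *\<^sub>R (\<i> * u))"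
        by (simp add: lin algebra_simps)
      then show ?thesis using \<open>m > 0\<close> by simp
    qed
    finally show "1 < norm (inverse m *\<^sub>R L u + r *\<^sub>R (inverse m *\<^sub>R L (\<i> * u)))" .
  qed
qed

section \<open>Placing the vertices level by level\<close>

text \<open>Heights on consecutive levels get opposite signs, so \<open>z + z'\<close> is the
  vertical distance to be compared with the norms. Each level assigns values to all of
  \<open>V\<close>, which keeps depths out of the recursion.\<close>

lemma next_level:
  fixes e a :: "'a::real_normed_vector" and t :: "'v \<Rightarrow> real"
  assumes e: "norm e = 1" and touch: "\<And>r. r \<noteq> 0 \<Longrightarrow> 1 < norm (e + r *\<^sub>R a)"
    and V: "finite V" and par: "\<And>v. v \<in> V \<Longrightarrow> par v \<in> V"
    and inj: "inj_on t V" and z: "0 < z" "z < 1"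
  obtains t' z' where "inj_on t' V" "0 < z'" "z' < 1"
    "\<And>v. v \<in> V \<Longrightarrow> norm (e + (t' v - t (par v)) *\<^sub>R a) < z + z'"
    "\<And>v w. v \<in> V \<Longrightarrow> w \<in> V \<Longrightarrow> w \<noteq> par v \<Longrightarrow> z + z' < norm (e + (t' v - t w) *\<^sub>R a)"
proof -
  \<comment> \<open>As \<open>t\<close> is injective, each of these finitely many norms exceeds 1,
    so they all exceed \<open>1 + h\<close> for small \<open>h\<close>.\<close>
  have "\<forall>\<^sub>F h in at_right 0. \<forall>u\<in>V. \<forall>w\<in>V. u \<noteq> w \<longrightarrow> 1 + h < norm (e + (t u - t w) *\<^sub>R a)"
  proof (intro eventually_ball_finite ballI V)
    fix u w assume uw: "u \<in> V" "w \<in> V"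
    have "((\<lambda>h. 1 + h) \<longlongrightarrow> 1 + 0) (at_right (0::real))"
      by (intro tendsto_intros)
    then have "\<forall>\<^sub>F h in at_right 0. 1 + h < norm (e + (t u - t w) *\<^sub>R a)" if "u \<noteq> w"
      using touch[of "t u - t w"] inj uw that by (intro order_tendstoD(2)) (auto simp: inj_on_eq_iff)
    then show "\<forall>\<^sub>F h in at_right 0. u \<noteq> w \<longrightarrow> 1 + h < norm (e + (t u - t w) *\<^sub>R a)"
      by (cases "u = w") auto
  qed
  \<comment> \<open>The bound \<open>h < z\<close> makes the later choice
    \<open>z' = 1 + h - z\<close> less than 1.\<close>
  moreover have "\<forall>\<^sub>F h in at_right 0. 0 < h \<and> h < z"
    using z eventually_at_right_real[of 0 z] by simp
  ultimately have "\<forall>\<^sub>F h in at_right 0. (\<forall>u\<in>V. \<forall>w\<in>V. u \<noteq> w \<longrightarrow>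
      1 + h < norm (e + (t u - t w) *\<^sub>R a)) \<and> 0 < h \<and> h < z"
    by (rule eventually_conj)
  from eventually_happens'[OF trivial_limit_at_right_real this]
  obtain h where h: "0 < h" "h < z"
    and sep: "\<forall>u\<in>V. \<forall>w\<in>V. u \<noteq> w \<longrightarrow> 1 + h < norm (e + (t u - t w) *\<^sub>R a)"
    by (elim exE conjE)
  obtain idx :: "'v \<Rightarrow> nat" where idx: "inj_on idx V"
    using finite_imp_inj_to_nat_seg[OF V] by blast
  \<comment> \<open>Each vertex copies the value of its parent. The multiples of
    \<open>\<epsilon>\<close> separate siblings, while vertices with different parents stay apart by
    continuity.\<close>
  define s where "s \<epsilon> v = t (par v) + \<epsilon> * real (idx v)" for \<epsilon> v
  have lim: "((\<lambda>\<epsilon>. s \<epsilon> v) \<longlongrightarrow> t (par v)) (at_right 0)" for v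
    unfolding s_def by (auto intro!: tendsto_eq_intros)
  have lim_norm: "((\<lambda>\<epsilon>. norm (e + (s \<epsilon> v - x) *\<^sub>R a)) \<longlongrightarrow> norm (e + (t (par v) - x) *\<^sub>R a)) (at_right 0)"
    for v x by (intro tendsto_intros lim)
  have "\<forall>\<^sub>F \<epsilon> in at_right 0. \<forall>v\<in>V. \<forall>w\<in>V. v \<noteq> w \<longrightarrow> s \<epsilon> v \<noteq> s \<epsilon> w"
  proof (intro eventually_ball_finite ballI V)
    fix v w assume vw: "v \<in> V" "w \<in> V"
    show "\<forall>\<^sub>F \<epsilon> in at_right 0. v \<noteq> w \<longrightarrow> s \<epsilon> v \<noteq> s \<epsilon> w"
    proof (cases "par v = par w")
      case True
      have "\<forall>\<^sub>F \<epsilon> in at_right (0::real). \<epsilon> > 0"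
        by (rule eventually_at_right_less)
      then show ?thesis
      proof eventually_elim
        case (elim \<epsilon>)
        then show ?case
          using True vw idx by (auto simp: s_def inj_on_eq_iff)
      qed
    next
      case False
      then have "t (par v) - t (par w) \<noteq> 0"
        using inj par vw by (auto simp: inj_on_eq_iff)
      moreover have "((\<lambda>\<epsilon>. s \<epsilon> v - s \<epsilon> w) \<longlongrightarrow> t (par v) - t (par w)) (at_right 0)"
        by (intro tendsto_intros lim)
      ultimately have "\<forall>\<^sub>F \<epsilon> in at_right 0. s \<epsilon> v - s \<epsilon> w \<noteq> 0"
        by (rule tendsto_imp_eventually_ne[rotated])
      then show ?thesis
        by eventually_elim auto
    qed
  qed
  moreover have "\<forall>\<^sub>F \<epsilon> in at_right 0. \<forall>v\<in>V. norm (e + (s \<epsilon> v - t (par v)) *\<^sub>R a) < 1 + h"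
    using e h by (intro eventually_ball_finite ballI V order_tendstoD(2)[OF lim_norm]) simp
  moreover have "\<forall>\<^sub>F \<epsilon> in at_right 0. \<forall>v\<in>V. \<forall>w\<in>V. w \<noteq> par v \<longrightarrow>
      1 + h < norm (e + (s \<epsilon> v - t w) *\<^sub>R a)"
  proof (intro eventually_ball_finite ballI V)
    fix v w assume vw: "v \<in> V" "w \<in> V"
    show "\<forall>\<^sub>F \<epsilon> in at_right 0. w \<noteq> par v \<longrightarrow> 1 + h < norm (e + (s \<epsilon> v - t w) *\<^sub>R a)"
    proof (cases "w = par v")
      case False
      then have "1 + h < norm (e + (t (par v) - t w) *\<^sub>R a)"
        using sep par vw by simp
      from order_tendstoD(1)[OF lim_norm this] show ?thesis
        by eventually_elim simp
    qed simp
  qed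
  ultimately have "\<forall>\<^sub>F \<epsilon> in at_right 0. inj_on (s \<epsilon>) V \<and>
      (\<forall>v\<in>V. norm (e + (s \<epsilon> v - t (par v)) *\<^sub>R a) < 1 + h) \<and>
      (\<forall>v\<in>V. \<forall>w\<in>V. w \<noteq> par v \<longrightarrow> 1 + h < norm (e + (s \<epsilon> v - t w) *\<^sub>R a))"
    by eventually_elim (auto simp: inj_on_def)
  from eventually_happens'[OF trivial_limit_at_right_real this]
  obtain \<epsilon> where \<epsilon>: "inj_on (s \<epsilon>) V"
      "\<forall>v\<in>V. norm (e + (s \<epsilon> v - t (par v)) *\<^sub>R a) < 1 + h"
      "\<forall>v\<in>V. \<forall>w\<in>V. w \<noteq> par v \<longrightarrow> 1 + h < norm (e + (s \<epsilon> v - t w) *\<^sub>R a)"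
    by (elim exE conjE)
  show thesis
    by (rule that[of "s \<epsilon>" "1 + h - z"]) (use \<epsilon> h z in auto)
qed

text \<open>Dependent choice iterates the passage to the next level: \<open>P\<close> is the
  invariant of a level and \<open>Q\<close> relates consecutive levels. Any injective values can
  serve as level 0.\<close>

lemma levels:
  fixes e a :: "'a::real_normed_vector"
  assumes e: "norm e = 1" and touch: "\<And>r. r \<noteq> 0 \<Longrightarrow> 1 < norm (e + r *\<^sub>R a)"
    and V: "finite V" and par: "\<And>v. v \<in> V \<Longrightarrow> par v \<in> V"
  obtains t :: "nat \<Rightarrow> 'v \<Rightarrow> real" and z :: "nat \<Rightarrow> real"
  where "\<And>d. inj_on (t d) V" "\<And>d. 0 < z d" "\<And>d. z d < 1"
    "\<And>d v. v \<in> V \<Longrightarrow> norm (e + (t (Suc d) v - t d (par v)) *\<^sub>R a) < z d + z (Suc d)"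
    "\<And>d v w. v \<in> V \<Longrightarrow> w \<in> V \<Longrightarrow> w \<noteq> par v \<Longrightarrow>
      z d + z (Suc d) < norm (e + (t (Suc d) v - t d w) *\<^sub>R a)"
proof -
  define P where "P = (\<lambda>(t :: 'v \<Rightarrow> real, z). inj_on t V \<and> 0 < z \<and> z < (1::real))"
  define Q where "Q = (\<lambda>(t, z) (t', z'). \<forall>v\<in>V. norm (e + (t' v - t (par v)) *\<^sub>R a) < z + z' \<and>
    (\<forall>w\<in>V. w \<noteq> par v \<longrightarrow> z + z' < norm (e + (t' v - t w) *\<^sub>R a)))"
  obtain idx :: "'v \<Rightarrow> nat" where "inj_on idx V"
    using finite_imp_inj_to_nat_seg[OF V] by blast
  then have start: "P (\<lambda>v. real (idx v), 1/2)"
    by (simp add: P_def inj_on_def)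
  have step: "\<exists>y. P y \<and> Q x y" if "P x" for x
  proof -
    obtain t z where x: "x = (t, z)" by (cases x)
    then have t: "inj_on t V" "0 < z" "z < 1"
      using that by (auto simp: P_def)
    show ?thesis
    proof (rule next_level[of e a V par t z])
      fix t' z'
      assume "inj_on t' V" "0 < z'" "z' < 1"
        and "\<And>v. v \<in> V \<Longrightarrow> norm (e + (t' v - t (par v)) *\<^sub>R a) < z + z'"
        and "\<And>v w. v \<in> V \<Longrightarrow> w \<in> V \<Longrightarrow> w \<noteq> par v \<Longrightarrow> z + z' < norm (e + (t' v - t w) *\<^sub>R a)"
      then have "P (t', z')" "Q (t, z) (t', z')"
        unfolding P_def Q_def case_prod_conv by blast+
      then show ?thesis unfolding x by blast
    qed (fact e touch V par t)+
  qed
  have "\<exists>f. \<forall>d. P (f d) \<and> Q (f d) (f (Suc d))"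
    by (rule dependent_nat_choice) (use start step in blast)+
  then obtain f where f: "\<And>d. P (f d)" "\<And>d. Q (f d) (f (Suc d))"
    by blast
  show thesis
    by (rule that[of "\<lambda>d. fst (f d)" "\<lambda>d. snd (f d)"])
      (use f in \<open>auto simp: P_def Q_def case_prod_beta\<close>)
qed

section \<open>The cone\<close>

text \<open>Moving \<open>q\<close> by less than \<open>r\<close> changes each of the two compared
  quantities by less than \<open>r\<close>, and their gap is \<open>2 * r\<close>.\<close>

lemma in_interior_cyl_cone:
  assumes "norm (linf_fst q) < \<bar>linf_snd q\<bar>"
  shows "q \<in> interior cyl_cone"
proof -
  define r where "r = (\<bar>linf_snd q\<bar> - norm (linf_fst q)) / 2"
  have "ball q r \<subseteq> cyl_cone"
  proof
    fix x assume "x \<in> ball q r"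
    then have "norm (linf_fst q - linf_fst x) < r" "\<bar>linf_snd q - linf_snd x\<bar> < r"
      by (auto simp: dist_norm norm_linf_sum_def minus_linf_sum_def)
    then show "x \<in> cyl_cone"
      using norm_triangle_ineq2[of "linf_fst x" "linf_fst q"]
      unfolding cyl_cone_def r_def by (simp add: norm_minus_commute) argo
  qed
  moreover have "r > 0" using assms by (simp add: r_def)
  ultimately show ?thesis by (auto simp: mem_interior)
qed

section \<open>Assembling the placement and comparing the two coordinates of the edge
  vectors\<close>

theorem lemma2p4:
  fixes G T :: "'v ugraph"
  assumes finite_dim: "\<exists>B :: 'a::real_normed_vector set. finite B \<and> span B = UNIV"
    and dim_ge_2: "dim (UNIV :: 'a set) \<ge> 2"
    and graph: "simple_graph G"
    and forest: "spanning_forest T G"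
  shows "\<exists>p :: 'v \<Rightarrow> 'a cyl. framework G p
           \<and> (\<forall>v w. {v, w} \<in> edges T \<longrightarrow> p v - p w \<in> interior cyl_cone)
           \<and> (\<forall>v w. {v, w} \<in> edges G - edges T \<longrightarrow> p v - p w \<in> - cyl_cone)"
proof -
  obtain e a :: 'a where e: "norm e = 1"
    and touch: "\<And>r. r \<noteq> 0 \<Longrightarrow> 1 < norm (e + r *\<^sub>R a)" and a: "a \<noteq> 0"
    using line_touching_unit_ball[OF dim_ge_2] by blast
  have T: "simple_graph T" "\<nexists>c. is_cycle T c" "verts T = verts G" "edges T \<subseteq> edges G"
    using forest by (auto simp: spanning_forest_def subgraph_def)
  obtain par and depth :: "'v \<Rightarrow> nat" where
    par: "\<And>v. v \<in> verts G \<Longrightarrow> par v \<in> verts G" and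
    edges: "\<And>v w. v \<in> verts G \<Longrightarrow> w \<in> verts G \<Longrightarrow> {v, w} \<in> edges T \<longleftrightarrow>
      par w = v \<and> depth w = Suc (depth v) \<or> par v = w \<and> depth v = Suc (depth w)"
    using acyclic_parent_depth[OF T(1,2)] unfolding T(3) by metis
  have V: "finite (verts G)" using graph by (simp add: simple_graph_def)
  have edgeD: "v \<noteq> w \<and> v \<in> verts G \<and> w \<in> verts G" if "{v, w} \<in> edges G" for v w
    using graph that unfolding simple_graph_def by (metis doubleton_eq_iff)
  obtain t :: "nat \<Rightarrow> 'v \<Rightarrow> real" and z where inj: "\<And>d. inj_on (t d) (verts G)"
    and z: "\<And>d. 0 < z d" "\<And>d. z d < 1"
    and child: "\<And>d v. v \<in> verts G \<Longrightarrow>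
      norm (e + (t (Suc d) v - t d (par v)) *\<^sub>R a) < z d + z (Suc d)"
    and not_child: "\<And>d v w. v \<in> verts G \<Longrightarrow> w \<in> verts G \<Longrightarrow> w \<noteq> par v \<Longrightarrow>
      z d + z (Suc d) < norm (e + (t (Suc d) v - t d w) *\<^sub>R a)"
    using levels[of e a "verts G" par] e touch V par by blast
  define p where "p v = Linf (real (depth v) *\<^sub>R e + t (depth v) v *\<^sub>R a) ((-1) ^ depth v * z (depth v))"
    for v
  \<comment> \<open>\<open>X < Y\<close> puts the difference into the interior of the cone and
    \<open>Y < X\<close> into the complement, so only these two numbers need to be compared.\<close>
  define X where "X v w = norm (linf_fst (p v - p w))" for v w
  define Y where "Y v w = \<bar>linf_snd (p v - p w)\<bar>" for v w
  have X_commute: "X v w = X w v" and Y_commute: "Y v w = Y w v" for v w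
    by (simp_all add: X_def Y_def minus_linf_sum_def norm_minus_commute abs_minus_commute)
  have X_eq: "X w v = norm ((real (depth w) - real (depth v)) *\<^sub>R e
      + (t (depth w) w - t (depth v) v) *\<^sub>R a)" for v w
    by (simp add: X_def p_def minus_linf_sum_def algebra_simps)
  have Y_eq: "Y w v = \<bar>(-1) ^ depth w * z (depth w) - (-1) ^ depth v * z (depth v)\<bar>" for v w
    by (simp add: Y_def p_def minus_linf_sum_def)
  \<comment> \<open>The depths have opposite parity, so the heights add up in absolute
    value.\<close>
  have consecutive: "X w v = norm (e + (t (Suc (depth v)) w - t (depth v) v) *\<^sub>R a)"
      "Y w v = z (depth v) + z (Suc (depth v))" if "depth w = Suc (depth v)" for v w
    using z[of "depth v"] z[of "Suc (depth v)"] that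
    by (simp_all add: X_eq Y_eq) (cases "even (depth v)"; simp)
  \<comment> \<open>Both heights are below 1 in absolute value, so \<open>Y w v < 2\<close>.
    Factoring out the depth difference \<open>k\<close> leaves a point of the line
    \<open>e + \<real> a\<close>, whose norm is at least 1.\<close>
  have far: "Y w v < X w v" if "depth w \<ge> depth v + 2" for v w
  proof -
    define k where "k = real (depth w) - real (depth v)"
    have k: "k \<ge> 2" using that by (simp add: k_def)
    have "Y w v < 2"
      using z[of "depth v"] z[of "depth w"] unfolding Y_eq
      by (cases "even (depth v)"; cases "even (depth w)") auto
    also have "2 \<le> k" by (fact k)
    also have "\<dots> \<le> k * norm (e + ((t (depth w) w - t (depth v) v) / k) *\<^sub>R a)"
      using k e touch[of "(t (depth w) w - t (depth v) v) / k"]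
      by (cases "(t (depth w) w - t (depth v) v) / k = 0") auto
    also have "\<dots> = norm (k *\<^sub>R (e + ((t (depth w) w - t (depth v) v) / k) *\<^sub>R a))"
      using k by simp
    also have "\<dots> = X w v"
      unfolding X_eq k_def[symmetric] scaleR_add_right scaleR_scaleR using k by simp
    finally show ?thesis .
  qed
  have tree: "X v w < Y v w" if "{v, w} \<in> edges T" for v w
  proof -
    have vw: "v \<in> verts G" "w \<in> verts G" using that T(4) edgeD by blast+
    from that edges[OF this]
    consider "par w = v" "depth w = Suc (depth v)" | "par v = w" "depth v = Suc (depth w)"
      by blast
    then show ?thesis
    proof cases
      case 1
      then show ?thesis
        using child[OF vw(2)] consecutive[of w v] by (simp add: X_commute[of v] Y_commute[of v])
    next
      case 2
      then show ?thesis
        using child[OF vw(1)] consecutive[of v w] by simp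
    qed
  qed
  have aux: "Y w v < X w v"
    if "{v, w} \<notin> edges T" "v \<noteq> w" "v \<in> verts G" "w \<in> verts G" "depth v \<le> depth w" for v w
  proof -
    have "depth w = depth v \<or> depth w = Suc (depth v) \<or> depth w \<ge> depth v + 2"
      using that(5) by linarith
    then consider "depth w = depth v" | "depth w = Suc (depth v)" | "depth w \<ge> depth v + 2"
      by blast
    then show ?thesis
    proof cases
      \<comment> \<open>At equal depth the heights agree, so \<open>Y w v = 0\<close>, while the
        first coordinates differ by a nonzero multiple of \<open>a\<close>.\<close>
      case 1
      moreover have "t (depth v) w \<noteq> t (depth v) v"
        using inj that by (metis inj_onD)
      ultimately show ?thesis using a by (simp add: X_eq Y_eq)
    next
      case 2
      \<comment> \<open>With consecutive depths, a pair that is not a tree edge satisfies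
        \<open>v \<noteq> par w\<close>.\<close>
      then show ?thesis
        using that(1) edges[OF that(3,4)] not_child[OF that(4,3)] consecutive by metis
    qed (rule far)
  qed
  have non_tree: "Y v w < X v w" if "{v, w} \<in> edges G - edges T" for v w
  proof -
    have "{v, w} \<notin> edges T" "{w, v} \<notin> edges T" "v \<noteq> w" "v \<in> verts G" "w \<in> verts G"
      using that edgeD[of v w] by (simp_all add: insert_commute)
    then show ?thesis
      using aux[of v w] aux[of w v] X_commute Y_commute nat_le_linear by metis
  qed
  \<comment> \<open>Coinciding points would give \<open>X v w = Y v w = 0\<close>, but one of the
    two strict inequalities holds on every edge of \<open>G\<close>.\<close>
  have "p v \<noteq> p w" if "{v, w} \<in> edges G" for v w
  proof
    assume "p v = p w"
    then have "X v w = Y v w"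
      by (simp add: X_def Y_def zero_linf_sum_def)
    then show False using tree[of v w] non_tree[of v w] that by (metis DiffI less_irrefl)
  qed
  then have "framework G p" using graph by (simp add: framework_def)
  moreover have "p v - p w \<in> interior cyl_cone" if "{v, w} \<in> edges T" for v w
    using tree[OF that] unfolding X_def Y_def by (rule in_interior_cyl_cone)
  moreover have "p v - p w \<in> - cyl_cone" if "{v, w} \<in> edges G - edges T" for v w
    using non_tree[OF that] by (simp add: X_def Y_def cyl_cone_def)
  ultimately show ?thesis by blast
qed

end
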